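(* Let $\delta\ge 0$, let $\{L_{\delta,f}\}_{f\in B_w}$ be a family of Markov bounded operators $L_{\delta,f}:B_w\to B_w$ preserving $B_s$ and $B_{ss}$, and let $\mathcal{L}_\delta(f):=L_{\delta,f}(f)$ be the associated self-consistent transfer operator. Assume: (a) (fixed point) there is $h\in B_{ss}\cap P_w$ with $\mathcal{L}_\delta h=h$; (b) (boundedness) there is $C\ge 0$ such that for each $f\in B_w$: $\|L_{\delta,f}\|_{w\to w}\le C$, $\|L_{\delta,f}\|_{s\to s}\le C$, $\|L_{\delta,f}\|_{ss\to ss}\le C$; (c) (sequential Lasota-Yorke inequalities) there are $\lambda_0<1$ and $A,B>0$ such that for each $n\in\mathbb{N}$, all $f_1,\dots,f_n\in P_w$ and $g\in B_s$ $$\|L_{\delta,f_1}\circ\dots\circ L_{\delta,f_n}(g)\|_w\le B\|g\|_w,\qquad \|L_{\delta,f_1}\circ\dots\circ L_{\delta,f_n}(g)\|_s\le A\lambda_0^n\|g\|_s+B\|g\|_w;$$ (d) (convergence to equilibrium for $L_{\delta,h}$) there are $a_n\ge 0$ with $a_n\to 0$ such that $\|L_{\delta,h}^n(\mu)\|_w\le a_n\|\mu\|_s$ for all $n\in\mathbb{N}$ and $\mu\in V_s$; (e) (regularity of the family) there is $C_0>0$ such that for all $f,g\in B_s$ $$\|L_{\delta,f}(h)-L_{\delta,g}(h)\|_s\le \delta C_0\|h\|_{ss}\|f-g\|_w,$$ and there is $C_1>0$ such that for all $f_1,f_2\in B_w$ and $g\in B_s$ $$\|L_{\delta,f_1}(g)-L_{\delta,f_2}(g)\|_w\le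 \delta C_1\|g\|_s\|f_1-f_2\|_w;$$ (f) (differentiability at $h$) there is a bounded linear operator $\partial L_{\delta,h}:(V_w,\|\cdot\|_w)\to (V_s,\|\cdot\|_s)$ such that $$\lim_{g\in V_w,\ \|g\|_w\to 0}\frac{\|L_{\delta,h+g}(h)-L_{\delta,h}(h)-\partial L_{\delta,h}(g)\|_s}{\|g\|_w}=0.$$ Let $d\mathcal{L}_{\delta,h}:=L_{\delta,h}+\partial L_{\delta,h}:V_s\to V_s$ be the differential of $\mathcal{L}_\delta$ at $h$. Assume furthermore that 1. $\partial L_{\delta,h}$ takes values in $B_{ss}$ and is bounded as an operator $(V_w,\|\cdot\|_w)\to(B_{ss},\|\cdot\|_{ss})$; 2. there are $n\in\mathbb{N}$ and a positive real $\lambda<1$ such that $\|d\mathcal{L}_{\delta,h}^n(g)\|_s\le\lambda\|g\|_s$ for all $g\in V_s$. Then $d\mathcal{L}_{\delta,h}$ satisfies a Lasota-Yorke inequality: there are $0\le\tilde\lambda<1$ and $C_4,C_5\ge 0$ such that for each $n\in\mathbb{N}$ and $g\in V_s$ $$\|d\mathcal{L}_{\delta,h}^n(g)\|_s\le \tilde\lambda^nC_4\|g\|_s+C_5\|g\|_w.$$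
   Context: $X$ is a metric space, $P(X)$ the set of Borel probability measures on $X$, $SM(X)$ the vector space of signed Borel measures on $X$. Fix normed vector subspaces $(B_{ss},\|\cdot\|_{ss})\subseteq(B_s,\|\cdot\|_s)\subseteq(B_w,\|\cdot\|_w)\subseteq SM(X)$ with $\|\cdot\|_{ss}\ge\|\cdot\|_s\ge\|\cdot\|_w$ (on the spaces where both sides are defined). Set $P_w:=P(X)\cap B_w$, $V_w:=\{\mu\in B_w:\mu(X)=0\}$, $V_s:=V_w\cap B_s$. For $\tau,\tau'\in\{ss,s,w\}$, $\|\cdot\|_{\tau\to\tau'}$ is the operator norm from $B_\tau$ to $B_{\tau'}$. A Markov operator is a linear operator mapping positive measures to positive measures and preserving total mass $\mu(X)$. The operator $\mathcal{L}_\delta$ maps $P_w$ to $P_w$, and the same formula $\mathcal{L}_\delta(f)=L_{\delta,f}(f)$ is used for $f\in B_w$. The operator $d\mathcal{L}_{\delta,h}$ is the differential of $\mathcal{L}_\delta$ at $h$ in the sense that $\|\mathcal{L}_\delta(h+g)-\mathcal{L}_\delta(h)-d\mathcal{L}_{\delta,h}(g)\|_w/\|g\|_s\to 0$ as $\|g\|_s\to 0$, $g\in V_s$. *)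

theory Defs
  imports "HOL-Probability.Probability_Measure"
begin

text \<open>
  A signed Borel measure is a real-valued (hence finite) countably additive set function on the
  Borel sets. As for \<^const>\<open>measure\<close>, values on non-Borel sets are fixed to be 0, so
  that equality of signed measures is equality on Borel sets.
\<close>

typedef (overloaded) 'a signed_measure =
  "{\<mu> :: 'a::metric_space set \<Rightarrow> real.
     (\<forall>A. A \<notin> sets borel \<longrightarrow> \<mu> A = 0) \<and>
     (\<forall>A :: nat \<Rightarrow> 'a set. range A \<subseteq> sets borel \<longrightarrow> disjoint_family A \<longrightarrow>
        (\<lambda>i. \<mu> (A i)) sums \<mu> (\<Union>i. A i))}"
  morphisms sm_val Abs_signed_measure
  by (rule exI[of _ "\<lambda>_. 0"]) simp

setup_lifting type_definition_signed_measure

instantiation signed_measure :: (metric_space) real_vector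
begin

lift_definition zero_signed_measure :: "'a signed_measure" is "\<lambda>_. 0"
  by simp

lift_definition plus_signed_measure ::
  "'a signed_measure \<Rightarrow> 'a signed_measure \<Rightarrow> 'a signed_measure" is "\<lambda>\<mu> \<nu> A. \<mu> A + \<nu> A"
  by (auto intro: sums_add)

lift_definition uminus_signed_measure :: "'a signed_measure \<Rightarrow> 'a signed_measure"
  is "\<lambda>\<mu> A. - \<mu> A"
  by (auto intro: sums_minus)

lift_definition minus_signed_measure ::
  "'a signed_measure \<Rightarrow> 'a signed_measure \<Rightarrow> 'a signed_measure" is "\<lambda>\<mu> \<nu> A. \<mu> A - \<nu> A"
  by (auto intro: sums_diff)

lift_definition scaleR_signed_measure :: "real \<Rightarrow> 'a signed_measure \<Rightarrow> 'a signed_measure"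
  is "\<lambda>c \<mu> A. c * \<mu> A"
  by (auto intro: sums_mult)

instance
  by standard (transfer; auto simp: algebra_simps fun_eq_iff)+

end

definition mass :: "'a::metric_space signed_measure \<Rightarrow> real" where
  "mass \<mu> = sm_val \<mu> UNIV"

definition positive_sm :: "'a::metric_space signed_measure \<Rightarrow> bool" where
  "positive_sm \<mu> \<longleftrightarrow> (\<forall>A \<in> sets borel. 0 \<le> sm_val \<mu> A)"

definition borel_probabilities :: "'a::metric_space signed_measure set" where
  "borel_probabilities =
     {\<mu>. \<exists>M :: 'a measure. sets M = sets borel \<and> prob_space M \<and> sm_val \<mu> = measure M}"

definition zero_mass :: "'a::metric_space signed_measure set \<Rightarrow> 'a signed_measure set" where
  "zero_mass B = {\<mu> \<in> B. mass \<mu> = 0}"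

text \<open>
  Normed subspaces are pairs of a carrier \<open>B\<close> and a function \<open>N\<close> on the ambient
  space; the values of \<open>N\<close> outside \<open>B\<close> are irrelevant.
\<close>

definition normed_subspace :: "'v::real_vector set \<Rightarrow> ('v \<Rightarrow> real) \<Rightarrow> bool" where
  "normed_subspace B N \<longleftrightarrow>
     subspace B \<and>
     (\<forall>x\<in>B. 0 \<le> N x) \<and>
     (\<forall>x\<in>B. N x = 0 \<longleftrightarrow> x = 0) \<and>
     (\<forall>c. \<forall>x\<in>B. N (c *\<^sub>R x) = \<bar>c\<bar> * N x) \<and>
     (\<forall>x\<in>B. \<forall>y\<in>B. N (x + y) \<le> N x + N y)"

definition linear_between ::
  "'v::real_vector set \<Rightarrow> 'w::real_vector set \<Rightarrow> ('v \<Rightarrow> 'w) \<Rightarrow> bool" where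
  "linear_between B B' T \<longleftrightarrow>
     T ` B \<subseteq> B' \<and>
     (\<forall>x\<in>B. \<forall>y\<in>B. T (x + y) = T x + T y) \<and>
     (\<forall>c. \<forall>x\<in>B. T (c *\<^sub>R x) = c *\<^sub>R T x)"

text \<open>
  The operator norm takes values in the extended nonnegative reals, so that it is meaningful (namely infinite)
  for unbounded operators.
\<close>

definition op_norm ::
  "'v::real_vector set \<Rightarrow> ('v \<Rightarrow> real) \<Rightarrow> ('w \<Rightarrow> real) \<Rightarrow> ('v \<Rightarrow> 'w) \<Rightarrow> ennreal" where
  "op_norm B N N' T = (SUP x \<in> B - {0}. ennreal (N' (T x) / N x))"

definition bounded_linear_between ::
  "'v::real_vector set \<Rightarrow> ('v \<Rightarrow> real) \<Rightarrow> 'w::real_vector set \<Rightarrow> ('w \<Rightarrow> real) \<Rightarrow> ('v \<Rightarrow> 'w) \<Rightarrow> bool"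
  where
  "bounded_linear_between B N B' N' T \<longleftrightarrow> linear_between B B' T \<and> op_norm B N N' T < \<infinity>"

definition markov_operator ::
  "'a::metric_space signed_measure set \<Rightarrow> ('a signed_measure \<Rightarrow> 'a signed_measure) \<Rightarrow> bool" where
  "markov_operator B T \<longleftrightarrow>
     linear_between B B T \<and>
     (\<forall>\<mu>\<in>B. positive_sm \<mu> \<longrightarrow> positive_sm (T \<mu>)) \<and>
     (\<forall>\<mu>\<in>B. mass (T \<mu>) = mass \<mu>)"

definition self_consistent :: "('v \<Rightarrow> 'v \<Rightarrow> 'v) \<Rightarrow> 'v \<Rightarrow> 'v" where
  "self_consistent L f = L f f"

text \<open>
  Product rule for \<open>f \<mapsto> L f f\<close> at \<open>h\<close>: \<open>L\<close> is differentiated in its operator argument, with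
  \<open>D\<close> the derivative of \<open>f \<mapsto> L f h\<close> at \<open>h\<close>, and in the measure argument, where it is linear.
\<close>

definition self_consistent_diff ::
  "('v::real_vector \<Rightarrow> 'v \<Rightarrow> 'v) \<Rightarrow> ('v \<Rightarrow> 'v) \<Rightarrow> 'v \<Rightarrow> 'v \<Rightarrow> 'v" where
  "self_consistent_diff L D h g = L h g + D g"

text \<open>The filter for limits as \<open>N g\<close> tends to 0 through nonzero elements \<open>g\<close> of \<open>V\<close>.\<close>

definition at_zero_in :: "'v set \<Rightarrow> ('v \<Rightarrow> real) \<Rightarrow> 'v filter" where
  "at_zero_in V N = inf (filtercomap N (at_right 0)) (principal V)"

end

theory Submission
  imports Defs
begin

text \<open>
  The contraction hypothesis already gives the inequality with \<open>C\<^sub>5 = 0\<close>: the differential is bounded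
  on \<open>V\<^sub>s\<close>, and a bounded operator one of whose iterates is a contraction has exponentially
  decaying iterates.
\<close>

lemma normed_subspace_subset:
  assumes "normed_subspace B N" "subspace V" "V \<subseteq> B"
  shows "normed_subspace V N"
  using assms by (simp add: normed_subspace_def subset_iff)

lemma normed_subspace_zero: "normed_subspace B N \<Longrightarrow> N 0 = 0"
  unfolding normed_subspace_def by (simp add: subspace_0)

lemma linear_between_zero:
  assumes "linear_between B B' T" "0 \<in> B"
  shows "T 0 = 0"
  using assms unfolding linear_between_def by (metis scaleR_zero_left)

text \<open>The supremum in \<open>op_norm\<close> runs over nonzero vectors only. There
  definiteness gives \<open>N x > 0\<close> and the quotient bound can be multiplied out; at the
  zero vector linearity makes both sides vanish.\<close>

lemma op_norm_bound:
  assumes T: "linear_between B B' T"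
    and B: "normed_subspace B N" and B': "normed_subspace B' N'"
    and C: "op_norm B N N' T \<le> ennreal C" "0 \<le> C"
    and x: "x \<in> B"
  shows "N' (T x) \<le> C * N x"
proof (cases "x = 0")
  case True
  have "0 \<in> B"
    using x True by simp
  then show ?thesis
    using True linear_between_zero[OF T] normed_subspace_zero[OF B] normed_subspace_zero[OF B']
    by simp
next
  case False
  then have "N x > 0"
    using B x unfolding normed_subspace_def by (metis order_le_less)
  moreover have "ennreal (N' (T x) / N x) \<le> ennreal C"
    using C x False unfolding op_norm_def SUP_le_iff by simp
  then have "N' (T x) / N x \<le> C"
    using C(2) by (simp add: ennreal_le_iff)
  ultimately show ?thesis
    by (simp add: pos_divide_le_eq)
qed

text \<open>A finite extended nonnegative real is the image of an ordinary real \<open>K\<close>,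
  which turns abstract boundedness into a usable estimate.\<close>

lemma bounded_linear_between_bound:
  assumes T: "bounded_linear_between B N B' N' T"
    and B: "normed_subspace B N" and B': "normed_subspace B' N'"
  obtains K where "0 \<le> K" "\<And>x. x \<in> B \<Longrightarrow> N' (T x) \<le> K * N x"
proof -
  have lin: "linear_between B B' T" and "op_norm B N N' T < top"
    using T unfolding bounded_linear_between_def by auto
  then obtain K where K: "0 \<le> K" "op_norm B N N' T = ennreal K"
    by (metis ennreal_cases less_irrefl)
  then show ?thesis
    using that op_norm_bound[OF lin B B'] by simp
qed

lemma mass_zero [simp]: "mass 0 = 0"
  by (simp add: mass_def zero_signed_measure.rep_eq)

lemma mass_add [simp]: "mass (\<mu> + \<nu>) = mass \<mu> + mass \<nu>"
  by (simp add: mass_def plus_signed_measure.rep_eq)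

lemma mass_scaleR [simp]: "mass (c *\<^sub>R \<mu>) = c * mass \<mu>"
  by (simp add: mass_def scaleR_signed_measure.rep_eq)

lemma subspace_zero_mass: "subspace B \<Longrightarrow> subspace (zero_mass B)"
  unfolding subspace_def zero_mass_def by simp

lemma iterate_mem:
  assumes "\<And>g. g \<in> V \<Longrightarrow> T g \<in> V" "g \<in> V"
  shows "(T ^^ n) g \<in> V"
  by (induction n) (use assms in auto)

text \<open>Used both for single steps of an operator and for whole blocks of \<open>n\<close>
  steps, with the block operator \<open>T ^^ n\<close> in the role of \<open>T\<close>.\<close>

lemma iterate_bound:
  fixes N :: "'v \<Rightarrow> real"
  assumes T: "\<And>g. g \<in> V \<Longrightarrow> T g \<in> V"
    and M: "0 \<le> M" "\<And>g. g \<in> V \<Longrightarrow> N (T g) \<le> M * N g"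
    and g: "g \<in> V"
  shows "N ((T ^^ n) g) \<le> M ^ n * N g"
proof (induction n)
  case (Suc n)
  have "N ((T ^^ Suc n) g) \<le> M * N ((T ^^ n) g)"
    using M(2)[OF iterate_mem[of V T, OF T g]] by simp
  also have "\<dots> \<le> M * (M ^ n * N g)"
    using Suc M(1) by (rule mult_left_mono)
  finally show ?case
    by (simp add: mult.assoc)
qed simp

text \<open>Split \<open>m\<close> steps into \<open>q\<close> full blocks of length
  \<open>n\<close> and a remainder of \<open>s\<close> steps. Each full block contributes a factor
  \<open>lam\<close>, while the remainder costs at most a constant independent of
  \<open>m\<close>.\<close>

lemma exponential_decay_of_iterate_contraction:
  fixes N :: "'v \<Rightarrow> real"
  assumes N: "\<And>g. g \<in> V \<Longrightarrow> 0 \<le> N g"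
    and T: "\<And>g. g \<in> V \<Longrightarrow> T g \<in> V"
    and M: "\<And>g. g \<in> V \<Longrightarrow> N (T g) \<le> M * N g"
    and lam: "0 < lam" "lam < 1"
    and contr: "\<And>g. g \<in> V \<Longrightarrow> N ((T ^^ n) g) \<le> lam * N g"
  shows "\<exists>r C. 0 \<le> r \<and> r < 1 \<and> 0 \<le> C \<and> (\<forall>m. \<forall>g\<in>V. N ((T ^^ m) g) \<le> r ^ m * C * N g)"
proof (cases "n = 0")
  case True
  \<comment> \<open>For \<open>n = 0\<close> the contraction reads
    \<open>N g \<le> lam * N g\<close> with \<open>lam < 1\<close>, which forces \<open>N\<close> to
    vanish on \<open>V\<close>; rate and constant 0 then suffice.\<close>
  have "N g = 0" if "g \<in> V" for g
  proof -
    have "(1 - lam) * N g \<le> 0"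
      using contr[OF that] True by (simp add: algebra_simps)
    then show ?thesis
      using N[OF that] lam by (simp add: mult_le_0_iff)
  qed
  then show ?thesis
    using iterate_mem[of V T, OF T] by (intro exI[of _ 0]) simp
next
  case False
  \<comment> \<open>The rate per step is chosen so that \<open>n\<close> steps give exactly the
    factor \<open>lam\<close>.\<close>
  define r where "r = root n lam"
  \<comment> \<open>Raising the bound to at least 1 makes its powers increasing, so
    \<open>K ^ s\<close> is at most \<open>K ^ n\<close> for every remainder
    \<open>s\<close>.\<close>
  define K where "K = max 1 M"
  have r: "0 < r" "r < 1" and rn: "r ^ n = lam"
    using False lam unfolding r_def by simp_all
  have K: "N (T g) \<le> K * N g" if "g \<in> V" for g
    using M[OF that] mult_right_mono[of M K "N g"] N[OF that] unfolding K_def by auto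
  have "N ((T ^^ m) g) \<le> r ^ m * (K ^ n / lam) * N g" if g: "g \<in> V" for m g
  proof -
    define q s where "q = m div n" and "s = m mod n"
    have m: "m = s + n * q" and s: "s \<le> n"
      using False unfolding q_def s_def by (simp_all add: less_imp_le)
    have K1: "1 \<le> K"
      unfolding K_def by simp
    define g' where "g' = (T ^^ (n * q)) g"
    have g': "g' \<in> V" unfolding g'_def using T g by (rule iterate_mem)
    \<comment> \<open>Regrouping the full blocks as \<open>q\<close> iterations of
      \<open>T ^^ n\<close> brings in the contraction.\<close>
    have "N g' = N (((T ^^ n) ^^ q) g)"
      unfolding g'_def by (simp add: funpow_mult)
    also have "\<dots> \<le> lam ^ q * N g"
      by (rule iterate_bound[of V]) (use g lam contr iterate_mem[of V T, OF T] in auto)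
    finally have N_g': "N g' \<le> lam ^ q * N g" .
    \<comment> \<open>Since \<open>lam\<close> is \<open>r ^ n\<close> and \<open>s \<le> n\<close>,
      replacing \<open>lam ^ q\<close> by \<open>r ^ m\<close> loses at most a factor
      \<open>1 / lam\<close>; this is the source of the denominator in the constant.\<close>
    have "lam \<le> r ^ s"
      unfolding rn[symmetric] using s r by (intro power_decreasing) auto
    then have "lam * lam ^ q \<le> r ^ s * lam ^ q"
      using lam by (intro mult_right_mono) auto
    also have "\<dots> = r ^ m"
      unfolding m power_add power_mult rn ..
    finally have lam_q: "lam ^ q \<le> r ^ m / lam"
      using lam by (simp add: field_simps)
    have "N ((T ^^ m) g) = N ((T ^^ s) g')"
      unfolding g'_def m by (simp add: funpow_add)
    also have "\<dots> \<le> K ^ s * N g'"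
      by (rule iterate_bound[of V]) (use g' K K1 T in auto)
    also have "\<dots> \<le> K ^ n * (lam ^ q * N g)"
      using K1 s N[OF g'] N_g' by (intro mult_mono power_increasing) auto
    also have "\<dots> \<le> K ^ n * (r ^ m / lam * N g)"
      using lam_q K1 N[OF g] by (intro mult_left_mono mult_right_mono) auto
    finally show ?thesis
      by (simp add: mult_ac)
  qed
  moreover have "0 \<le> K ^ n / lam"
    using lam unfolding K_def by simp
  ultimately show ?thesis
    using r by (intro exI[of _ r] exI[of _ "K ^ n / lam"]) auto
qed

theorem lemma8:
  fixes Bss Bs Bw Vw Vs Pw :: "'a::metric_space signed_measure set"
    and Nss Ns Nw :: "'a signed_measure \<Rightarrow> real"
    and \<delta> :: real
    and L :: "'a signed_measure \<Rightarrow> 'a signed_measure \<Rightarrow> 'a signed_measure"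
    and D :: "'a signed_measure \<Rightarrow> 'a signed_measure"
    and h :: "'a signed_measure"
  defines "Pw \<equiv> borel_probabilities \<inter> Bw"
    and "Vw \<equiv> zero_mass Bw"
    and "Vs \<equiv> Vw \<inter> Bs"
  assumes "normed_subspace Bss Nss" "normed_subspace Bs Ns" "normed_subspace Bw Nw"
    and "Bss \<subseteq> Bs" "Bs \<subseteq> Bw"
    and "\<And>\<mu>. \<mu> \<in> Bss \<Longrightarrow> Ns \<mu> \<le> Nss \<mu>"
    and "\<And>\<mu>. \<mu> \<in> Bs \<Longrightarrow> Nw \<mu> \<le> Ns \<mu>"
    and "\<delta> \<ge> 0"
    and markov: "\<And>f. f \<in> Bw \<Longrightarrow>
           markov_operator Bw (L f) \<and> bounded_linear_between Bw Nw Bw Nw (L f) \<and>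
           L f ` Bs \<subseteq> Bs \<and> L f ` Bss \<subseteq> Bss"
    and fixed_point: "h \<in> Bss \<inter> Pw" "self_consistent L h = h"
    and boundedness: "\<exists>C\<ge>0. \<forall>f\<in>Bw.
           op_norm Bw Nw Nw (L f) \<le> ennreal C \<and>
           op_norm Bs Ns Ns (L f) \<le> ennreal C \<and>
           op_norm Bss Nss Nss (L f) \<le> ennreal C"
    and lasota_yorke: "\<exists>lam0 A B :: real. lam0 < 1 \<and> A > 0 \<and> B > 0 \<and>
           (\<forall>n\<ge>1. \<forall>fs. length fs = n \<longrightarrow> set fs \<subseteq> Pw \<longrightarrow> (\<forall>g\<in>Bs.
              Nw (foldr L fs g) \<le> B * Nw g \<and>
              Ns (foldr L fs g) \<le> A * lam0 ^ n * Ns g + B * Nw g))"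
    and equilibrium: "\<exists>a :: nat \<Rightarrow> real. (\<forall>n. a n \<ge> 0) \<and> a \<longlonglongrightarrow> 0 \<and>
           (\<forall>n\<ge>1. \<forall>\<mu>\<in>Vs. Nw ((L h ^^ n) \<mu>) \<le> a n * Ns \<mu>)"
    and regularity_s: "\<exists>C\<^sub>0>0. \<forall>f\<in>Bs. \<forall>g\<in>Bs.
           Ns (L f h - L g h) \<le> \<delta> * C\<^sub>0 * Nss h * Nw (f - g)"
    and regularity_w: "\<exists>C\<^sub>1>0. \<forall>f\<^sub>1\<in>Bw. \<forall>f\<^sub>2\<in>Bw. \<forall>g\<in>Bs.
           Nw (L f\<^sub>1 g - L f\<^sub>2 g) \<le> \<delta> * C\<^sub>1 * Ns g * Nw (f\<^sub>1 - f\<^sub>2)"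
    and differentiability: "bounded_linear_between Vw Nw Vs Ns D"
      "((\<lambda>g. Ns (L (h + g) h - L h h - D g) / Nw g) \<longlongrightarrow> 0) (at_zero_in Vw Nw)"
    and derivative_ss: "bounded_linear_between Vw Nw Bss Nss D"
    and contraction: "\<exists>n. \<exists>lam::real. 0 < lam \<and> lam < 1 \<and>
           (\<forall>g\<in>Vs. Ns ((self_consistent_diff L D h ^^ n) g) \<le> lam * Ns g)"
  shows "\<exists>lam' C\<^sub>4 C\<^sub>5 :: real. 0 \<le> lam' \<and> lam' < 1 \<and> C\<^sub>4 \<ge> 0 \<and> C\<^sub>5 \<ge> 0 \<and>
           (\<forall>n. \<forall>g\<in>Vs. Ns ((self_consistent_diff L D h ^^ n) g) \<le> lam' ^ n * C\<^sub>4 * Ns g + C\<^sub>5 * Nw g)"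
proof -
  let ?T = "self_consistent_diff L D h"
  have sub: "subspace Bs" "subspace Bw"
    using assms(5,6) unfolding normed_subspace_def by auto
  have Vw: "normed_subspace Vw Nw"
    unfolding Vw_def using assms(6) subspace_zero_mass[OF sub(2)]
    by (rule normed_subspace_subset) (auto simp: zero_mass_def)
  have Vs: "normed_subspace Vs Ns"
    unfolding Vs_def Vw_def using assms(5) subspace_inter[OF subspace_zero_mass[OF sub(2)] sub(1)]
    by (rule normed_subspace_subset) auto
  have h: "h \<in> Bw"
    using fixed_point(1) unfolding Pw_def by simp
  have Lh: "linear_between Bw Bw (L h)" "\<And>\<mu>. \<mu> \<in> Bw \<Longrightarrow> mass (L h \<mu>) = mass \<mu>"
    "L h ` Bs \<subseteq> Bs"
    using markov[OF h] unfolding markov_operator_def by auto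
  \<comment> \<open>Linearity is given on the weak space; invariance of \<open>Bs\<close> restricts
    it, so that the strong operator norm can be used.\<close>
  have Lh_s: "linear_between Bs Bs (L h)"
    using Lh(1,3) \<open>Bs \<subseteq> Bw\<close> unfolding linear_between_def by blast
  obtain C where C: "0 \<le> C" "op_norm Bs Ns Ns (L h) \<le> ennreal C"
    using boundedness h by blast
  obtain K where K: "0 \<le> K" "\<And>g. g \<in> Vw \<Longrightarrow> Ns (D g) \<le> K * Nw g"
    using bounded_linear_between_bound[OF differentiability(1) Vw Vs] by blast
  \<comment> \<open>Preservation of mass keeps the total mass zero, and invariance of
    \<open>Bs\<close> keeps the image in the strong space.\<close>
  have L_V: "L h g \<in> Vs" if "g \<in> Vs" for g
    using that Lh unfolding Vs_def Vw_def linear_between_def by (auto simp: zero_mass_def)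
  have D_V: "D g \<in> Vs" if "g \<in> Vs" for g
    using that differentiability(1) Vs_def
    unfolding bounded_linear_between_def linear_between_def by auto
  have T_V: "?T g \<in> Vs" if "g \<in> Vs" for g
    unfolding self_consistent_diff_def
    using Vs L_V[OF that] D_V[OF that] by (auto simp: normed_subspace_def intro: subspace_add)
  have T_bound: "Ns (?T g) \<le> (C + K) * Ns g" if g: "g \<in> Vs" for g
  proof -
    have gs: "g \<in> Vw" "g \<in> Bs"
      using g unfolding Vs_def by auto
    have "Ns (?T g) \<le> Ns (L h g) + Ns (D g)"
      using Vs L_V[OF g] D_V[OF g] unfolding self_consistent_diff_def normed_subspace_def by simp
    also have "\<dots> \<le> C * Ns g + K * Nw g"
      using op_norm_bound[OF Lh_s assms(5,5) C(2,1) gs(2)] K(2)[OF gs(1)] by (rule add_mono)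
    \<comment> \<open>The derivative part is controlled by the weak norm, which the strong norm
      dominates on \<open>Bs\<close>.\<close>
    also have "\<dots> \<le> (C + K) * Ns g"
      using K(1) assms(10)[OF gs(2)] by (simp add: distrib_right mult_left_mono)
    finally show ?thesis .
  qed
  have Ns_nonneg: "0 \<le> Ns g" if "g \<in> Vs" for g
    using Vs that unfolding normed_subspace_def by simp
  obtain n lam where lam: "0 < lam" "lam < 1"
    and contr: "\<And>g. g \<in> Vs \<Longrightarrow> Ns ((?T ^^ n) g) \<le> lam * Ns g"
    using contraction by blast
  have "\<exists>r C. 0 \<le> r \<and> r < 1 \<and> 0 \<le> C \<and> (\<forall>m. \<forall>g\<in>Vs. Ns ((?T ^^ m) g) \<le> r ^ m * C * Ns g)"
    by (rule exponential_decay_of_iterate_contraction[OF Ns_nonneg T_V T_bound lam contr])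
  then obtain r C\<^sub>4 where "0 \<le> r" "r < 1" "0 \<le> C\<^sub>4"
    "\<forall>m. \<forall>g\<in>Vs. Ns ((?T ^^ m) g) \<le> r ^ m * C\<^sub>4 * Ns g"
    by blast
  then show ?thesis
    by (intro exI[of _ r] exI[of _ C\<^sub>4] exI[of _ 0]) simp
qed

end
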